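(* For any order-preserving maps $\mathbf{F},\mathbf{G}:(\mathbf{Int},\leq)\to\mathbb{Z}_{\geq0}^{\mathrm{op}}$, the erosion distance $d_{\mathrm{I}}(\mathbf{F},\mathbf{G})$ satisfies $$d_{\mathrm{I}}(\mathbf{F},\mathbf{G})=\sup_{n\in\mathbb{Z}_{\geq0}}d_{\mathrm{H}}\left(\mathbf{F}^{-1}[0,n],\mathbf{G}^{-1}[0,n]\right).$$
   Context: $\mathbf{Int}:=\{(a,b)\in\mathbb{R}^2:a\leq b\}$ with the order $(a,b)\leq(a',b')$ iff $a'\leq a\leq b\leq b'$ (interval inclusion), equipped with the flow $\Omega_\varepsilon(a,b)=(a-\varepsilon,b+\varepsilon)$, $\varepsilon\in[0,\infty)$. $\mathbb{Z}_{\geq0}^{\mathrm{op}}$ is the set of nonnegative integers with the reversed order ($m\leq n$ in $\mathbb{Z}_{\geq0}^{\mathrm{op}}$ iff $n\leq m$ as integers). $\mathbf{F}^{-1}[0,n]=\{I\in\mathbf{Int}: 0\leq\mathbf{F}(I)\leq n\text{ as integers}\}$. The erosion distance between $\mathbf{F}$ and $\mathbf{G}$ is the interleaving distance $d_{\mathrm{I}}(\mathbf{F},\mathbf{G}):=\inf\{\varepsilon\in[0,\infty):\mathbf{F}(I)\leq\mathbf{G}(\Omega_\varepsilon(I))\text{ and }\mathbf{G}(I)\leq\mathbf{F}(\Omega_\varepsilon(I))\text{ in }\mathbb{Z}_{\geq0}^{\mathrm{op}}\text{ for all }I\in\mathbf{Int}\}$ (with $\inf\emptyset=\infty$). $d_{\mathrm{H}}$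 is the Hausdorff distance in $\mathbf{Int}$ with the metric induced by $\|\cdot\|_\infty$: for $A,B\subset\mathbf{Int}$, $d_{\mathrm{H}}(A,B):=\inf\{\varepsilon\in[0,\infty):A\subset B^\varepsilon\text{ and }B\subset A^\varepsilon\}$ ($\inf\emptyset=\infty$), where $A^\varepsilon:=\{x\in\mathbf{Int}:\exists a\in A,\ \|a-x\|_\infty\leq\varepsilon\}$. *)

theory Defs
  imports
    "HOL-Analysis.Analysis"
    "HOL-Library.Interval"
    "HOL-Library.Dual_Ordered_Lattice"
begin

text \<open>
  The poset \<open>Int\<close> is the library type \<open>real interval\<close>, i.e. the pairs \<open>(a, b)\<close> with \<open>a \<le> b\<close>,
  ordered by inclusion (see \<open>Interval_le_iff\<close> below). The nonnegative integers with the
  reversed order are \<open>nat dual\<close>; \<open>undual\<close> recovers the underlying integer.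

  Distances take values in \<open>ennreal\<close>, where the infimum of the empty set is \<open>\<infinity>\<close>.
\<close>

text \<open>Meaningful for \<open>\<epsilon> \<ge> 0\<close> only; for negative \<open>\<epsilon>\<close> the endpoints may fail to be ordered.\<close>

definition flow :: "real \<Rightarrow> real interval \<Rightarrow> real interval"
  where "flow \<epsilon> I = Interval (lower I - \<epsilon>, upper I + \<epsilon>)"

definition interleaving_dist ::
    "(real interval \<Rightarrow> nat dual) \<Rightarrow> (real interval \<Rightarrow> nat dual) \<Rightarrow> ennreal"
  where "interleaving_dist F G =
    (INF \<epsilon>\<in>{\<epsilon>::real. 0 \<le> \<epsilon> \<and> (\<forall>I. F I \<le> G (flow \<epsilon> I) \<and> G I \<le> F (flow \<epsilon> I))}. ennreal \<epsilon>)"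

definition thickening :: "real interval set \<Rightarrow> real \<Rightarrow> real interval set"
  where "thickening A \<epsilon> =
    {x. \<exists>a\<in>A. infnorm (bounds_of_interval a - bounds_of_interval x) \<le> \<epsilon>}"

definition hausdorff_dist :: "real interval set \<Rightarrow> real interval set \<Rightarrow> ennreal"
  where "hausdorff_dist A B =
    (INF \<epsilon>\<in>{\<epsilon>::real. 0 \<le> \<epsilon> \<and> A \<subseteq> thickening B \<epsilon> \<and> B \<subseteq> thickening A \<epsilon>}. ennreal \<epsilon>)"

text \<open>The preimage of \<open>[0, n]\<close>, where \<open>[0, n]\<close> refers to the usual order of the integers.\<close>

definition sublevel :: "(real interval \<Rightarrow> nat dual) \<Rightarrow> nat \<Rightarrow> real interval set"
  where "sublevel F n = {I. undual (F I) \<in> {0..n}}"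

lemma Interval_le_iff:
  fixes a b a' b' :: real
  assumes "a \<le> b" "a' \<le> b'"
  shows "Interval (a, b) \<le> Interval (a', b') \<longleftrightarrow> a' \<le> a \<and> b \<le> b'"
  using assms by (simp add: less_eq_interval_def lower.rep_eq upper.rep_eq Interval_inverse)

lemma lower_flow [simp]: "0 \<le> \<epsilon> \<Longrightarrow> lower (flow \<epsilon> I) = lower I - \<epsilon>"
  and upper_flow [simp]: "0 \<le> \<epsilon> \<Longrightarrow> upper (flow \<epsilon> I) = upper I + \<epsilon>"
proof -
  assume "0 \<le> \<epsilon>"
  with lower_le_upper[of I] have "lower I - \<epsilon> \<le> upper I + \<epsilon>"
    by linarith
  then show "lower (flow \<epsilon> I) = lower I - \<epsilon>" "upper (flow \<epsilon> I) = upper I + \<epsilon>"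
    by (simp_all add: flow_def lower.rep_eq upper.rep_eq Interval_inverse)
qed

lemma infnorm_bounds_of_interval:
  "infnorm (bounds_of_interval I - bounds_of_interval J) =
    max \<bar>lower I - lower J\<bar> \<bar>upper I - upper J\<bar>"
  by (simp add: infnorm_Max Basis_prod_def image_Un image_image Max_Un
      lower.rep_eq upper.rep_eq inner_prod_def)

end

theory Submission
  imports Defs
begin

text \<open>
  For a fixed \<open>\<epsilon> \<ge> 0\<close>, the one-sided interleaving condition \<open>F I \<le> G (flow \<epsilon> I)\<close> for all \<open>I\<close> says
  exactly that every sublevel set of \<open>F\<close> lies in the \<open>\<epsilon>\<close>-thickening of the corresponding sublevel
  set of \<open>G\<close> (lemma \<open>interleaved_iff_sublevel_subset_thickening\<close>). The reason is that \<open>flow \<epsilon> I\<close> is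
  the largest interval within distance \<open>\<epsilon>\<close> of \<open>I\<close>, and monotonicity of \<open>G\<close> makes sublevel sets
  closed under passing to larger intervals: if some interval near \<open>I\<close> belongs to a sublevel set of
  \<open>G\<close>, then so does \<open>flow \<epsilon> I\<close>.

  Hence the set of \<open>\<epsilon>\<close> admissible for the interleaving distance is the intersection over \<open>n\<close> of the
  sets admissible for the Hausdorff distances of the \<open>n\<close>-th sublevel sets. Each of these is an
  up-set of reals, and for up-sets the infimum of an intersection is the supremum of the infima
  (lemma \<open>INF_Inter_up_sets\<close>), whether or not the infima are attained.
\<close>

lemma sublevel_up_closed:
  assumes "mono F" and "I \<in> sublevel F n" and "I \<le> J"
  shows "J \<in> sublevel F n"
proof -
  have "undual (F J) \<le> undual (F I)"
    using monoD[OF assms(1,3)] by (simp only: dual_less_eq_iff)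
  then show ?thesis
    using assms(2) by (simp add: sublevel_def)
qed

lemma le_dual_iff_sublevel: "F I \<le> G J \<longleftrightarrow> J \<in> sublevel G (undual (F I))"
  by (simp add: sublevel_def dual_less_eq_iff)

lemma flow_within:
  assumes "0 \<le> \<epsilon>"
  shows "infnorm (bounds_of_interval (flow \<epsilon> I) - bounds_of_interval I) \<le> \<epsilon>"
  using assms by (simp add: infnorm_bounds_of_interval)

lemma within_imp_le_flow:
  assumes "0 \<le> \<epsilon>" and "infnorm (bounds_of_interval J - bounds_of_interval I) \<le> \<epsilon>"
  shows "J \<le> flow \<epsilon> I"
  using assms by (auto simp: infnorm_bounds_of_interval less_eq_interval_def)

lemma thickening_mono: "\<delta> \<le> \<epsilon> \<Longrightarrow> thickening A \<delta> \<subseteq> thickening A \<epsilon>"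
  by (force simp: thickening_def)

text \<open>
  The flow \<open>flow \<epsilon> I\<close> is itself a witness that \<open>I\<close> lies in the thickening, and it dominates every
  other witness. For the backward direction the level to test is \<open>n = F I\<close>, the smallest one whose
  sublevel set contains \<open>I\<close>.
\<close>

lemma interleaved_iff_sublevel_subset_thickening:
  assumes "mono G" and "0 \<le> \<epsilon>"
  shows "(\<forall>I. F I \<le> G (flow \<epsilon> I)) \<longleftrightarrow> (\<forall>n. sublevel F n \<subseteq> thickening (sublevel G n) \<epsilon>)"
proof (intro iffI allI subsetI)
  fix n I
  assume FG: "\<forall>I. F I \<le> G (flow \<epsilon> I)" and I: "I \<in> sublevel F n"
  have "undual (G (flow \<epsilon> I)) \<le> undual (F I)"
    using FG by (simp only: dual_less_eq_iff)
  then have "flow \<epsilon> I \<in> sublevel G n"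
    using I by (simp add: sublevel_def)
  then show "I \<in> thickening (sublevel G n) \<epsilon>"
    using flow_within[OF assms(2)] by (auto simp: thickening_def)
next
  fix I
  assume sub: "\<forall>n. sublevel F n \<subseteq> thickening (sublevel G n) \<epsilon>"
  have "I \<in> sublevel F (undual (F I))"
    by (simp add: sublevel_def)
  then obtain J where J: "J \<in> sublevel G (undual (F I))"
    and near: "infnorm (bounds_of_interval J - bounds_of_interval I) \<le> \<epsilon>"
    using sub unfolding thickening_def by blast
  have "flow \<epsilon> I \<in> sublevel G (undual (F I))"
    using sublevel_up_closed[OF assms(1) J] within_imp_le_flow[OF assms(2) near] .
  then show "F I \<le> G (flow \<epsilon> I)"
    by (simp add: le_dual_iff_sublevel)
qed

text \<open>
  Any real strictly above the supremum of the infima strictly exceeds some element of each up-set,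
  hence lies in all of them; letting it decrease to the supremum gives the nontrivial inequality.
\<close>

lemma INF_Inter_up_sets:
  fixes S :: "'i \<Rightarrow> real set"
  assumes up: "\<And>i \<delta> \<epsilon>. \<delta> \<in> S i \<Longrightarrow> \<delta> \<le> \<epsilon> \<Longrightarrow> \<epsilon> \<in> S i"
  shows "(INF \<epsilon>\<in>(\<Inter>i. S i). ennreal \<epsilon>) = (SUP i. INF \<epsilon>\<in>S i. ennreal \<epsilon>)"
proof (rule antisym)
  show "(INF \<epsilon>\<in>(\<Inter>i. S i). ennreal \<epsilon>) \<le> (SUP i. INF \<epsilon>\<in>S i. ennreal \<epsilon>)"
  proof (rule dense_ge)
    fix c
    assume c: "(SUP i. INF \<epsilon>\<in>S i. ennreal \<epsilon>) < c"
    show "(INF \<epsilon>\<in>(\<Inter>i. S i). ennreal \<epsilon>) \<le> c"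
    proof (cases c)
      case (real r)
      have "r \<in> S i" for i
      proof -
        have "(INF \<epsilon>\<in>S i. ennreal \<epsilon>) < ennreal r"
          using c real by (metis SUP_lessD UNIV_I)
        then obtain \<delta> where "\<delta> \<in> S i" "ennreal \<delta> < ennreal r"
          by (auto simp: INF_less_iff)
        then show ?thesis
          using up by (meson ennreal_leI leD le_cases)
      qed
      then show ?thesis
        using real by (auto intro: INF_lower)
    qed simp
  qed
next
  show "(SUP i. INF \<epsilon>\<in>S i. ennreal \<epsilon>) \<le> (INF \<epsilon>\<in>(\<Inter>i. S i). ennreal \<epsilon>)"
    by (intro SUP_least INF_superset_mono) auto
qed

theorem theorem4p3:
  fixes F G :: "real interval \<Rightarrow> nat dual"
  assumes "mono F" and "mono G"
  shows "interleaving_dist F G = (SUP n::nat. hausdorff_dist (sublevel F n) (sublevel G n))"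
proof -
  define S where "S n = {\<epsilon>::real. 0 \<le> \<epsilon> \<and> sublevel F n \<subseteq> thickening (sublevel G n) \<epsilon>
    \<and> sublevel G n \<subseteq> thickening (sublevel F n) \<epsilon>}" for n
  have "(\<forall>I. F I \<le> G (flow \<epsilon> I) \<and> G I \<le> F (flow \<epsilon> I)) \<longleftrightarrow>
    (\<forall>n. sublevel F n \<subseteq> thickening (sublevel G n) \<epsilon> \<and> sublevel G n \<subseteq> thickening (sublevel F n) \<epsilon>)"
    if "0 \<le> \<epsilon>" for \<epsilon>
    using interleaved_iff_sublevel_subset_thickening[OF assms(2) that, of F]
      interleaved_iff_sublevel_subset_thickening[OF assms(1) that, of G]
    by (simp only: all_conj_distrib)
  then have "{\<epsilon>::real. 0 \<le> \<epsilon> \<and> (\<forall>I. F I \<le> G (flow \<epsilon> I) \<and> G I \<le> F (flow \<epsilon> I))} = (\<Inter>n. S n)"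
    unfolding S_def by blast
  then have "interleaving_dist F G = (INF \<epsilon>\<in>(\<Inter>n. S n). ennreal \<epsilon>)"
    by (simp add: interleaving_dist_def)
  also have "\<dots> = (SUP n. INF \<epsilon>\<in>S n. ennreal \<epsilon>)"
  proof (rule INF_Inter_up_sets)
    fix n \<delta> \<epsilon>
    assume "\<delta> \<in> S n" "\<delta> \<le> \<epsilon>"
    then show "\<epsilon> \<in> S n"
      using thickening_mono[of \<delta> \<epsilon>] by (fastforce simp: S_def)
  qed
  finally show ?thesis
    by (simp add: hausdorff_dist_def S_def)
qed

end
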